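(* Let $R$ be a commutative ring, let $\mathcal C$ be a hull class, let $M$ be an $R$-module, and let $\mathfrak p\in\operatorname{Spec} R$. Assume: (1) $H_{\mathcal C}(M)$ exists; (2) $H_{\mathcal C}(M)_{\mathfrak p}\in\mathcal C$; (3) $H_{\mathcal C}(M)_{\mathfrak p}$ is not minimal among $\mathcal C$-extensions of $M_{\mathfrak p}$; (4) $H_{\mathcal C}(M_{\mathfrak p})$ exists. Then $H_{\mathcal C}(M)_{\mathfrak p}\not\cong H_{\mathcal C}(M_{\mathfrak p})$ as hulls over $M_{\mathfrak p}$.
   Context: A hull class is a class $\mathcal C$ of $R$-modules closed under isomorphism; localizations are regarded as $R$-modules when membership in $\mathcal C$ is considered. A $\mathcal C$-extension of $M$ is a monomorphism $M\hookrightarrow E$ with $E\in\mathcal C$. A $\mathcal C$-pre-envelope of $M$ is a $\mathcal C$-extension $\iota:M\hookrightarrow H$ such that every $\mathcal C$-extension $j:M\hookrightarrow E$ factors as $j=h\circ\iota$ with $h:H\to E$. A $\mathcal C$-hull of $M$, denoted $M\hookrightarrow H_{\mathcal C}(M)$, is a $\mathcal C$-pre-envelope $\iota:M\hookrightarrow H$ such that every endomorphism $u$ of $H$ with $u\circ\iota=\iota$ is an automorphism. A $\mathcal C$-extension is minimal among $\mathcal C$-extensions if it satisfies these two axioms (pre-envelope and endomorphism-minimality). $H_{\mathcal C}(M)_{\mathfrak p}$ is an extension of $M_{\mathfrak p}$ via the localized embedding; an isomorphism as hulls over $M_{\mathfrak p}$ is a module isomorphism compatible with the embeddings of $M_{\mathfrak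 p}$. *)

theory Defs
  imports "HOL-Algebra.Module" "HOL-Algebra.Ideal"
begin

text \<open>
  Modules are the records of HOL-Algebra. The ring fields \<open>mult\<close> and \<open>one\<close> that such a record
  carries for the module itself play no role; no notion below depends on them.
\<close>

definition mod_hom :: "('r, 'c) ring_scheme \<Rightarrow> ('r, 'a) module \<Rightarrow> ('r, 'b) module \<Rightarrow> ('a \<Rightarrow> 'b) set"
  where "mod_hom R M N = {f. f \<in> carrier M \<rightarrow> carrier N
    \<and> (\<forall>x\<in>carrier M. \<forall>y\<in>carrier M. f (x \<oplus>\<^bsub>M\<^esub> y) = f x \<oplus>\<^bsub>N\<^esub> f y)
    \<and> (\<forall>a\<in>carrier R. \<forall>x\<in>carrier M. f (a \<odot>\<^bsub>M\<^esub> x) = a \<odot>\<^bsub>N\<^esub> f x)}"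

definition mod_mono :: "('r, 'c) ring_scheme \<Rightarrow> ('r, 'a) module \<Rightarrow> ('r, 'b) module \<Rightarrow> ('a \<Rightarrow> 'b) set"
  where "mod_mono R M N = {f \<in> mod_hom R M N. inj_on f (carrier M)}"

definition mod_iso :: "('r, 'c) ring_scheme \<Rightarrow> ('r, 'a) module \<Rightarrow> ('r, 'b) module \<Rightarrow> ('a \<Rightarrow> 'b) set"
  where "mod_iso R M N = {f \<in> mod_hom R M N. bij_betw f (carrier M) (carrier N)}"

definition mod_isomorphic :: "('r, 'c) ring_scheme \<Rightarrow> ('r, 'a) module \<Rightarrow> ('r, 'b) module \<Rightarrow> bool"
  where "mod_isomorphic R M N \<longleftrightarrow> mod_iso R M N \<noteq> {}"


subsection \<open>Localization at a prime, as an \<open>R\<close>-module\<close>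

definition frac_rel :: "('r, 'c) ring_scheme \<Rightarrow> 'r set \<Rightarrow> ('r, 'a) module \<Rightarrow> (('a \<times> 'r) \<times> ('a \<times> 'r)) set"
  where "frac_rel R p M = {((x, s), (y, t)).
    x \<in> carrier M \<and> s \<in> carrier R - p \<and> y \<in> carrier M \<and> t \<in> carrier R - p
    \<and> (\<exists>u\<in>carrier R - p. u \<odot>\<^bsub>M\<^esub> (t \<odot>\<^bsub>M\<^esub> x) = u \<odot>\<^bsub>M\<^esub> (s \<odot>\<^bsub>M\<^esub> y))}"

text \<open>The fraction \<open>x / s\<close>.\<close>

definition frac :: "('r, 'c) ring_scheme \<Rightarrow> 'r set \<Rightarrow> ('r, 'a) module \<Rightarrow> 'a \<Rightarrow> 'r \<Rightarrow> ('a \<times> 'r) set"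
  where "frac R p M x s = frac_rel R p M `` {(x, s)}"

text \<open>
  Operations on classes are unions over representatives; all members of such a union coincide.
\<close>

definition localize :: "('r, 'c) ring_scheme \<Rightarrow> 'r set \<Rightarrow> ('r, 'a) module \<Rightarrow> ('r, ('a \<times> 'r) set) module"
  where "localize R p M =
    \<lparr>carrier = (carrier M \<times> (carrier R - p)) // frac_rel R p M,
     mult = (\<lambda>_ _. undefined), one = undefined,
     zero = frac R p M \<zero>\<^bsub>M\<^esub> \<one>\<^bsub>R\<^esub>,
     add = (\<lambda>X Y. \<Union>(x, s)\<in>X. \<Union>(y, t)\<in>Y.
       frac R p M ((t \<odot>\<^bsub>M\<^esub> x) \<oplus>\<^bsub>M\<^esub> (s \<odot>\<^bsub>M\<^esub> y)) (s \<otimes>\<^bsub>R\<^esub> t)),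
     smult = (\<lambda>a X. \<Union>(x, s)\<in>X. frac R p M (a \<odot>\<^bsub>M\<^esub> x) s)\<rparr>"

text \<open>For \<open>f\<close> from \<open>M\<close> to \<open>N\<close>, the map \<open>x / s \<mapsto> f x / s\<close> between the localizations.\<close>

definition localize_map ::
  "('r, 'c) ring_scheme \<Rightarrow> 'r set \<Rightarrow> ('r, 'b) module \<Rightarrow> ('a \<Rightarrow> 'b) \<Rightarrow> ('a \<times> 'r) set \<Rightarrow> ('b \<times> 'r) set"
  where "localize_map R p N f X = (\<Union>(x, s)\<in>X. frac R p N (f x) s)"


subsection \<open>Hull classes and hulls\<close>

text \<open>
  A class of modules is a set of modules whose carriers live in one arbitrary type \<open>'u\<close>, the
  universe. A module on any other type, such as a localization, belongs to the class if it is
  isomorphic to a member; for modules on \<open>'u\<close> itself this is plain membership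
  (\<open>in_class_iff\<close> below).
\<close>

definition hull_class :: "('r, 'c) ring_scheme \<Rightarrow> ('r, 'u) module set \<Rightarrow> bool"
  where "hull_class R C \<longleftrightarrow> (\<forall>N\<in>C. module R N)
    \<and> (\<forall>N\<in>C. \<forall>N'. module R N' \<and> mod_isomorphic R N N' \<longrightarrow> N' \<in> C)"

definition in_class :: "('r, 'c) ring_scheme \<Rightarrow> ('r, 'u) module set \<Rightarrow> ('r, 'a) module \<Rightarrow> bool"
  where "in_class R C N \<longleftrightarrow> module R N \<and> (\<exists>E\<in>C. mod_isomorphic R E N)"

lemma in_class_iff:
  assumes "hull_class R C"
  shows "in_class R C N \<longleftrightarrow> N \<in> C"
proof
  show "in_class R C N \<Longrightarrow> N \<in> C"
    using assms unfolding hull_class_def in_class_def by blast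
next
  assume "N \<in> C"
  moreover have "(\<lambda>x. x) \<in> mod_iso R N N"
    by (auto simp: mod_iso_def mod_hom_def bij_betw_def)
  ultimately show "in_class R C N"
    using assms unfolding hull_class_def in_class_def mod_isomorphic_def by blast
qed

definition class_extension ::
  "('r, 'c) ring_scheme \<Rightarrow> ('r, 'u) module set \<Rightarrow> ('r, 'a) module \<Rightarrow> ('a \<Rightarrow> 'b) \<Rightarrow> ('r, 'b) module \<Rightarrow> bool"
  where "class_extension R C M \<iota> E \<longleftrightarrow> in_class R C E \<and> \<iota> \<in> mod_mono R M E"

text \<open>
  It suffices to test the factorization against extensions \<open>E\<close> on the universe, since
  every module in the class is isomorphic to one there.
\<close>

definition pre_envelope ::
  "('r, 'c) ring_scheme \<Rightarrow> ('r, 'u) module set \<Rightarrow> ('r, 'a) module \<Rightarrow> ('a \<Rightarrow> 'b) \<Rightarrow> ('r, 'b) module \<Rightarrow> bool"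
  where "pre_envelope R C M \<iota> H \<longleftrightarrow> class_extension R C M \<iota> H
    \<and> (\<forall>(E :: ('r, 'u) module) j. class_extension R C M j E
         \<longrightarrow> (\<exists>h\<in>mod_hom R H E. \<forall>x\<in>carrier M. j x = h (\<iota> x)))"

definition endo_minimal ::
  "('r, 'c) ring_scheme \<Rightarrow> ('r, 'a) module \<Rightarrow> ('a \<Rightarrow> 'b) \<Rightarrow> ('r, 'b) module \<Rightarrow> bool"
  where "endo_minimal R M \<iota> H \<longleftrightarrow>
    (\<forall>u\<in>mod_hom R H H. (\<forall>x\<in>carrier M. u (\<iota> x) = \<iota> x) \<longrightarrow> u \<in> mod_iso R H H)"

definition class_hull ::
  "('r, 'c) ring_scheme \<Rightarrow> ('r, 'u) module set \<Rightarrow> ('r, 'a) module \<Rightarrow> ('a \<Rightarrow> 'b) \<Rightarrow> ('r, 'b) module \<Rightarrow> bool"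
  where "class_hull R C M \<iota> H \<longleftrightarrow> pre_envelope R C M \<iota> H \<and> endo_minimal R M \<iota> H"

definition minimal_extension ::
  "('r, 'c) ring_scheme \<Rightarrow> ('r, 'u) module set \<Rightarrow> ('r, 'a) module \<Rightarrow> ('a \<Rightarrow> 'b) \<Rightarrow> ('r, 'b) module \<Rightarrow> bool"
  where "minimal_extension R C M \<iota> E \<longleftrightarrow>
    class_extension R C M \<iota> E \<and> pre_envelope R C M \<iota> E \<and> endo_minimal R M \<iota> E"

definition isomorphic_over ::
  "('r, 'c) ring_scheme \<Rightarrow> ('r, 'a) module \<Rightarrow> ('a \<Rightarrow> 'b) \<Rightarrow> ('r, 'b) module \<Rightarrow> ('a \<Rightarrow> 'd) \<Rightarrow> ('r, 'd) module \<Rightarrow> bool"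
  where "isomorphic_over R M \<iota> H \<iota>' H' \<longleftrightarrow>
    (\<exists>\<phi>\<in>mod_iso R H H'. \<forall>x\<in>carrier M. \<phi> (\<iota> x) = \<iota>' x)"

end

theory Submission
  imports Defs
begin

text \<open>
  Being a hull depends only on the isomorphism class of an extension over the base module: if
  \<open>\<phi>\<close> is an isomorphism from \<open>E\<close> to \<open>E'\<close> over \<open>N\<close>, then every factorization through \<open>E'\<close>
  becomes one through \<open>E\<close> by composing with \<open>\<phi>\<close>, and conjugation by \<open>\<phi>\<close> carries the
  endomorphisms of \<open>E\<close> over \<open>N\<close> to those of \<open>E'\<close> over \<open>N\<close> (lemma \<open>class_hull_transfer\<close>).
  Hence if the localized hull were isomorphic over the localization of \<open>M\<close> to a hull of that
  localization, it would itself be a hull, that is, a minimal extension, against the assumption.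

  The transfer needs the localized embedding to be a monomorphism. So most of the work is to
  calculate with fractions as if they were formal quotients, which amounts to showing that the
  operations do not depend on representatives, and to conclude that localization preserves
  injective homomorphisms (lemma \<open>localize_map_mono\<close>).
\<close>

section \<open>Calculating with fractions\<close>

locale module_at_prime = module R M + primeideal p R
  for R :: "('r, 'c) ring_scheme" and M :: "('r, 'm) module" and p :: "'r set"
begin

lemma one_denom: "\<one>\<^bsub>R\<^esub> \<in> carrier R - p"
  using one_imp_carrier I_notcarr by auto

lemma mult_denom:
  assumes "s \<in> carrier R - p" "t \<in> carrier R - p"
  shows "s \<otimes>\<^bsub>R\<^esub> t \<in> carrier R - p"
  using assms I_prime by auto

text \<open>
  With the scalars merged, the well-definedness of the operations on fractions reduces to
  rearranging products in \<open>R\<close>.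
\<close>

lemma frac_rel_iff:
  "((x, s), (y, t)) \<in> frac_rel R p M \<longleftrightarrow>
    x \<in> carrier M \<and> s \<in> carrier R - p \<and> y \<in> carrier M \<and> t \<in> carrier R - p
    \<and> (\<exists>u\<in>carrier R - p. (u \<otimes>\<^bsub>R\<^esub> t) \<odot>\<^bsub>M\<^esub> x = (u \<otimes>\<^bsub>R\<^esub> s) \<odot>\<^bsub>M\<^esub> y)"
  by (auto simp: frac_rel_def smult_assoc1)

lemma scale_eq:
  assumes "a \<odot>\<^bsub>M\<^esub> x = b \<odot>\<^bsub>M\<^esub> y"
    and "a \<in> carrier R" "b \<in> carrier R" "c \<in> carrier R" "x \<in> carrier M" "y \<in> carrier M"
  shows "(c \<otimes>\<^bsub>R\<^esub> a) \<odot>\<^bsub>M\<^esub> x = (c \<otimes>\<^bsub>R\<^esub> b) \<odot>\<^bsub>M\<^esub> y"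
  using assms by (simp add: smult_assoc1)

text \<open>
  If \<open>u\<close> and \<open>v\<close> witness the two given relations, then \<open>u v t\<close> witnesses the third. The middle
  denominator \<open>t\<close> enters the witness, so it matters that denominators are closed under
  multiplication, that is, that \<open>p\<close> is prime.
\<close>

lemma frac_rel_trans:
  assumes "((x, s), (y, t)) \<in> frac_rel R p M" "((y, t), (z, r)) \<in> frac_rel R p M"
  shows "((x, s), (z, r)) \<in> frac_rel R p M"
proof -
  obtain u v where uv: "u \<in> carrier R - p" "v \<in> carrier R - p"
    and u: "(u \<otimes>\<^bsub>R\<^esub> t) \<odot>\<^bsub>M\<^esub> x = (u \<otimes>\<^bsub>R\<^esub> s) \<odot>\<^bsub>M\<^esub> y"
    and v: "(v \<otimes>\<^bsub>R\<^esub> r) \<odot>\<^bsub>M\<^esub> y = (v \<otimes>\<^bsub>R\<^esub> t) \<odot>\<^bsub>M\<^esub> z"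
    and c: "x \<in> carrier M" "y \<in> carrier M" "z \<in> carrier M"
    "s \<in> carrier R - p" "t \<in> carrier R - p" "r \<in> carrier R - p"
    using assms unfolding frac_rel_iff by blast
  have "((v \<otimes>\<^bsub>R\<^esub> r) \<otimes>\<^bsub>R\<^esub> (u \<otimes>\<^bsub>R\<^esub> t)) \<odot>\<^bsub>M\<^esub> x = ((v \<otimes>\<^bsub>R\<^esub> r) \<otimes>\<^bsub>R\<^esub> (u \<otimes>\<^bsub>R\<^esub> s)) \<odot>\<^bsub>M\<^esub> y"
    using scale_eq[OF u] uv c by simp
  also have "\<dots> = ((u \<otimes>\<^bsub>R\<^esub> s) \<otimes>\<^bsub>R\<^esub> (v \<otimes>\<^bsub>R\<^esub> r)) \<odot>\<^bsub>M\<^esub> y"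
    using uv c by (simp add: R.m_comm)
  also have "\<dots> = ((u \<otimes>\<^bsub>R\<^esub> s) \<otimes>\<^bsub>R\<^esub> (v \<otimes>\<^bsub>R\<^esub> t)) \<odot>\<^bsub>M\<^esub> z"
    using scale_eq[OF v] uv c by simp
  finally have "((u \<otimes>\<^bsub>R\<^esub> v \<otimes>\<^bsub>R\<^esub> t) \<otimes>\<^bsub>R\<^esub> r) \<odot>\<^bsub>M\<^esub> x = ((u \<otimes>\<^bsub>R\<^esub> v \<otimes>\<^bsub>R\<^esub> t) \<otimes>\<^bsub>R\<^esub> s) \<odot>\<^bsub>M\<^esub> z"
    using uv c by (simp add: R.m_ac)
  then show ?thesis
    using uv c mult_denom unfolding frac_rel_iff by blast
qed

lemma equiv_frac_rel: "equiv (carrier M \<times> (carrier R - p)) (frac_rel R p M)"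
proof (rule equivI)
  show "frac_rel R p M \<subseteq> (carrier M \<times> (carrier R - p)) \<times> (carrier M \<times> (carrier R - p))"
    by (auto simp: frac_rel_def)
  show "refl_on (carrier M \<times> (carrier R - p)) (frac_rel R p M)"
    using one_denom by (auto simp: refl_on_def frac_rel_def)
  show "sym (frac_rel R p M)"
    unfolding sym_def frac_rel_def by clarsimp (metis DiffI)
  show "trans (frac_rel R p M)"
    by (intro transI) (metis frac_rel_trans surj_pair)
qed

lemma frac_self:
  assumes "x \<in> carrier M" "s \<in> carrier R - p"
  shows "(x, s) \<in> frac R p M x s"
  unfolding frac_def using equiv_class_self[OF equiv_frac_rel] assms by simp

lemma frac_mem_iff: "(y, t) \<in> frac R p M x s \<longleftrightarrow> ((x, s), (y, t)) \<in> frac_rel R p M"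
  by (simp add: frac_def)

lemma frac_eqI: "((x, s), (y, t)) \<in> frac_rel R p M \<Longrightarrow> frac R p M x s = frac R p M y t"
  unfolding frac_def by (rule equiv_class_eq[OF equiv_frac_rel])

lemma frac_eq_iff:
  assumes "x \<in> carrier M" "s \<in> carrier R - p" "y \<in> carrier M" "t \<in> carrier R - p"
  shows "frac R p M x s = frac R p M y t \<longleftrightarrow> ((x, s), (y, t)) \<in> frac_rel R p M"
  unfolding frac_def using eq_equiv_class_iff[OF equiv_frac_rel] assms by simp

lemma frac_in_localize:
  assumes "x \<in> carrier M" "s \<in> carrier R - p"
  shows "frac R p M x s \<in> carrier (localize R p M)"
  using assms by (auto simp: localize_def frac_def intro: quotientI)

lemma localize_cases:
  assumes "X \<in> carrier (localize R p M)"
  obtains x s where "X = frac R p M x s" "x \<in> carrier M" "s \<in> carrier R - p"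
  using assms by (auto simp: localize_def frac_def elim!: quotientE)

text \<open>
  This evaluates the unions over representatives that define the operations and localized maps:
  only the independence of \<open>F\<close> from the representative is left to check.
\<close>

lemma Union_const_frac:
  assumes "x \<in> carrier M" "s \<in> carrier R - p"
    and "\<And>x' s'. ((x, s), (x', s')) \<in> frac_rel R p M \<Longrightarrow> F x' s' = F x s"
  shows "(\<Union>(x', s')\<in>frac R p M x s. F x' s') = F x s"
proof -
  have "F x' s' = F x s" if "(x', s') \<in> frac R p M x s" for x' s'
    using that assms(3) by (simp add: frac_mem_iff)
  then show ?thesis
    using frac_self[OF assms(1,2)] by blast
qed

lemma frac_smult:
  assumes a: "a \<in> carrier R" and x: "x \<in> carrier M" "s \<in> carrier R - p"
  shows "a \<odot>\<^bsub>localize R p M\<^esub> frac R p M x s = frac R p M (a \<odot>\<^bsub>M\<^esub> x) s"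
proof -
  have "frac R p M (a \<odot>\<^bsub>M\<^esub> x') s' = frac R p M (a \<odot>\<^bsub>M\<^esub> x) s"
    if rel: "((x, s), (x', s')) \<in> frac_rel R p M" for x' s'
  proof -
    obtain u where u: "u \<in> carrier R - p" "(u \<otimes>\<^bsub>R\<^esub> s') \<odot>\<^bsub>M\<^esub> x = (u \<otimes>\<^bsub>R\<^esub> s) \<odot>\<^bsub>M\<^esub> x'"
      and c: "x' \<in> carrier M" "s' \<in> carrier R - p"
      using rel unfolding frac_rel_iff by blast
    have "(a \<otimes>\<^bsub>R\<^esub> (u \<otimes>\<^bsub>R\<^esub> s')) \<odot>\<^bsub>M\<^esub> x = (a \<otimes>\<^bsub>R\<^esub> (u \<otimes>\<^bsub>R\<^esub> s)) \<odot>\<^bsub>M\<^esub> x'"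
      using scale_eq[OF u(2)] u(1) a x c by simp
    then have "(u \<otimes>\<^bsub>R\<^esub> s') \<odot>\<^bsub>M\<^esub> (a \<odot>\<^bsub>M\<^esub> x) = (u \<otimes>\<^bsub>R\<^esub> s) \<odot>\<^bsub>M\<^esub> (a \<odot>\<^bsub>M\<^esub> x')"
      using u(1) a x c by (simp add: smult_assoc1[symmetric] R.m_ac)
    then have "((a \<odot>\<^bsub>M\<^esub> x, s), (a \<odot>\<^bsub>M\<^esub> x', s')) \<in> frac_rel R p M"
      unfolding frac_rel_iff using u(1) a x c by blast
    then show ?thesis
      by (rule frac_eqI[symmetric])
  qed
  from Union_const_frac[OF x, of "\<lambda>x s. frac R p M (a \<odot>\<^bsub>M\<^esub> x) s", OF this]
  show ?thesis
    by (simp add: localize_def)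
qed

text \<open>
  The product of the witnesses for the two summands serves both of them: each summand's equation
  is scaled by the other witness and by the remaining denominators, and the results are added.
\<close>

lemma frac_add_cong:
  assumes "((x, s), (x', s')) \<in> frac_rel R p M" "((y, t), (y', t')) \<in> frac_rel R p M"
  shows "frac R p M ((t' \<odot>\<^bsub>M\<^esub> x') \<oplus>\<^bsub>M\<^esub> (s' \<odot>\<^bsub>M\<^esub> y')) (s' \<otimes>\<^bsub>R\<^esub> t')
    = frac R p M ((t \<odot>\<^bsub>M\<^esub> x) \<oplus>\<^bsub>M\<^esub> (s \<odot>\<^bsub>M\<^esub> y)) (s \<otimes>\<^bsub>R\<^esub> t)"
proof -
  obtain u v where u: "u \<in> carrier R - p" "(u \<otimes>\<^bsub>R\<^esub> s') \<odot>\<^bsub>M\<^esub> x = (u \<otimes>\<^bsub>R\<^esub> s) \<odot>\<^bsub>M\<^esub> x'"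
    and v: "v \<in> carrier R - p" "(v \<otimes>\<^bsub>R\<^esub> t') \<odot>\<^bsub>M\<^esub> y = (v \<otimes>\<^bsub>R\<^esub> t) \<odot>\<^bsub>M\<^esub> y'"
    and c: "x \<in> carrier M" "y \<in> carrier M" "x' \<in> carrier M" "y' \<in> carrier M"
    "s \<in> carrier R - p" "t \<in> carrier R - p" "s' \<in> carrier R - p" "t' \<in> carrier R - p"
    using assms unfolding frac_rel_iff by blast
  let ?w = "u \<otimes>\<^bsub>R\<^esub> v"
  have "((v \<otimes>\<^bsub>R\<^esub> t \<otimes>\<^bsub>R\<^esub> t') \<otimes>\<^bsub>R\<^esub> (u \<otimes>\<^bsub>R\<^esub> s')) \<odot>\<^bsub>M\<^esub> x
      = ((v \<otimes>\<^bsub>R\<^esub> t \<otimes>\<^bsub>R\<^esub> t') \<otimes>\<^bsub>R\<^esub> (u \<otimes>\<^bsub>R\<^esub> s)) \<odot>\<^bsub>M\<^esub> x'"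
    using scale_eq[OF u(2)] u(1) v(1) c by simp
  then have x: "(?w \<otimes>\<^bsub>R\<^esub> (s' \<otimes>\<^bsub>R\<^esub> t') \<otimes>\<^bsub>R\<^esub> t) \<odot>\<^bsub>M\<^esub> x = (?w \<otimes>\<^bsub>R\<^esub> (s \<otimes>\<^bsub>R\<^esub> t) \<otimes>\<^bsub>R\<^esub> t') \<odot>\<^bsub>M\<^esub> x'"
    using u(1) v(1) c by (simp add: R.m_ac)
  have "((u \<otimes>\<^bsub>R\<^esub> s \<otimes>\<^bsub>R\<^esub> s') \<otimes>\<^bsub>R\<^esub> (v \<otimes>\<^bsub>R\<^esub> t')) \<odot>\<^bsub>M\<^esub> y
      = ((u \<otimes>\<^bsub>R\<^esub> s \<otimes>\<^bsub>R\<^esub> s') \<otimes>\<^bsub>R\<^esub> (v \<otimes>\<^bsub>R\<^esub> t)) \<odot>\<^bsub>M\<^esub> y'"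
    using scale_eq[OF v(2)] u(1) v(1) c by simp
  then have y: "(?w \<otimes>\<^bsub>R\<^esub> (s' \<otimes>\<^bsub>R\<^esub> t') \<otimes>\<^bsub>R\<^esub> s) \<odot>\<^bsub>M\<^esub> y = (?w \<otimes>\<^bsub>R\<^esub> (s \<otimes>\<^bsub>R\<^esub> t) \<otimes>\<^bsub>R\<^esub> s') \<odot>\<^bsub>M\<^esub> y'"
    using u(1) v(1) c by (simp add: R.m_ac)
  have "(?w \<otimes>\<^bsub>R\<^esub> (s' \<otimes>\<^bsub>R\<^esub> t')) \<odot>\<^bsub>M\<^esub> ((t \<odot>\<^bsub>M\<^esub> x) \<oplus>\<^bsub>M\<^esub> (s \<odot>\<^bsub>M\<^esub> y))
      = (?w \<otimes>\<^bsub>R\<^esub> (s' \<otimes>\<^bsub>R\<^esub> t') \<otimes>\<^bsub>R\<^esub> t) \<odot>\<^bsub>M\<^esub> x \<oplus>\<^bsub>M\<^esub> (?w \<otimes>\<^bsub>R\<^esub> (s' \<otimes>\<^bsub>R\<^esub> t') \<otimes>\<^bsub>R\<^esub> s) \<odot>\<^bsub>M\<^esub> y"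
    using u(1) v(1) c by (simp add: smult_r_distr smult_assoc1)
  also have "\<dots> = (?w \<otimes>\<^bsub>R\<^esub> (s \<otimes>\<^bsub>R\<^esub> t)) \<odot>\<^bsub>M\<^esub> ((t' \<odot>\<^bsub>M\<^esub> x') \<oplus>\<^bsub>M\<^esub> (s' \<odot>\<^bsub>M\<^esub> y'))"
    unfolding x y using u(1) v(1) c by (simp add: smult_r_distr smult_assoc1)
  finally have "(((t \<odot>\<^bsub>M\<^esub> x) \<oplus>\<^bsub>M\<^esub> (s \<odot>\<^bsub>M\<^esub> y), s \<otimes>\<^bsub>R\<^esub> t),
      ((t' \<odot>\<^bsub>M\<^esub> x') \<oplus>\<^bsub>M\<^esub> (s' \<odot>\<^bsub>M\<^esub> y'), s' \<otimes>\<^bsub>R\<^esub> t')) \<in> frac_rel R p M"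
    unfolding frac_rel_iff using mult_denom[OF u(1) v(1)] c mult_denom by blast
  then show ?thesis
    by (rule frac_eqI[symmetric])
qed

lemma frac_add:
  assumes x: "x \<in> carrier M" "s \<in> carrier R - p" and y: "y \<in> carrier M" "t \<in> carrier R - p"
  shows "frac R p M x s \<oplus>\<^bsub>localize R p M\<^esub> frac R p M y t
    = frac R p M ((t \<odot>\<^bsub>M\<^esub> x) \<oplus>\<^bsub>M\<^esub> (s \<odot>\<^bsub>M\<^esub> y)) (s \<otimes>\<^bsub>R\<^esub> t)"
proof -
  let ?G = "\<lambda>x s y t. frac R p M ((t \<odot>\<^bsub>M\<^esub> x) \<oplus>\<^bsub>M\<^esub> (s \<odot>\<^bsub>M\<^esub> y)) (s \<otimes>\<^bsub>R\<^esub> t)"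
  have refl: "((x, s), (x, s)) \<in> frac_rel R p M" "((y, t), (y, t)) \<in> frac_rel R p M"
    using frac_self x y by (auto simp: frac_mem_iff)
  have inner: "(\<Union>(y', t')\<in>frac R p M y t. ?G x' s' y' t') = ?G x' s' y t"
    if "((x, s), (x', s')) \<in> frac_rel R p M" for x' s'
    using that frac_add_cong[OF that] refl(2)
    by (intro Union_const_frac[OF y, of "?G x' s'"]) metis
  have "(\<Union>(x', s')\<in>frac R p M x s. \<Union>(y', t')\<in>frac R p M y t. ?G x' s' y' t')
      = (\<Union>(y', t')\<in>frac R p M y t. ?G x s y' t')"
    by (intro Union_const_frac[OF x, of "\<lambda>x s. \<Union>(y', t')\<in>frac R p M y t. ?G x s y' t'"])
      (simp only: inner refl frac_add_cong)
  then show ?thesis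
    using inner[OF refl(1)] by (simp add: localize_def)
qed

end

section \<open>Localization preserves monomorphisms\<close>

lemma localize_map_frac:
  assumes "module R M" "module R N" "primeideal p R" and f: "f \<in> mod_hom R M N"
    and x: "x \<in> carrier M" "s \<in> carrier R - p"
  shows "localize_map R p N f (frac R p M x s) = frac R p N (f x) s"
proof -
  interpret M: module_at_prime R M p
    by (intro module_at_prime.intro assms)
  interpret N: module_at_prime R N p
    by (intro module_at_prime.intro assms)
  have "frac R p N (f x') s' = frac R p N (f x) s"
    if rel: "((x, s), (x', s')) \<in> frac_rel R p M" for x' s'
  proof -
    obtain u where u: "u \<in> carrier R - p" "(u \<otimes>\<^bsub>R\<^esub> s') \<odot>\<^bsub>M\<^esub> x = (u \<otimes>\<^bsub>R\<^esub> s) \<odot>\<^bsub>M\<^esub> x'"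
      and c: "x' \<in> carrier M" "s' \<in> carrier R - p"
      using rel unfolding M.frac_rel_iff by blast
    have "f ((u \<otimes>\<^bsub>R\<^esub> s') \<odot>\<^bsub>M\<^esub> x) = f ((u \<otimes>\<^bsub>R\<^esub> s) \<odot>\<^bsub>M\<^esub> x')"
      by (simp only: u(2))
    then have "(u \<otimes>\<^bsub>R\<^esub> s') \<odot>\<^bsub>N\<^esub> f x = (u \<otimes>\<^bsub>R\<^esub> s) \<odot>\<^bsub>N\<^esub> f x'"
      using f u(1) x c by (simp add: mod_hom_def)
    moreover have "f x \<in> carrier N" "f x' \<in> carrier N"
      using f x c by (auto simp: mod_hom_def)
    ultimately have "((f x, s), (f x', s')) \<in> frac_rel R p N"
      unfolding N.frac_rel_iff using u(1) x c by blast
    then show ?thesis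
      by (rule N.frac_eqI[symmetric])
  qed
  from M.Union_const_frac[OF x, of "\<lambda>x s. frac R p N (f x) s", OF this]
  show ?thesis
    by (simp add: localize_map_def)
qed

lemma localize_map_hom:
  assumes mods: "module R M" "module R N" "primeideal p R" and f: "f \<in> mod_hom R M N"
  shows "localize_map R p N f \<in> mod_hom R (localize R p M) (localize R p N)"
proof -
  interpret M: module_at_prime R M p
    by (intro module_at_prime.intro assms)
  interpret N: module_at_prime R N p
    by (intro module_at_prime.intro assms)
  note map = localize_map_frac[OF mods f]
  have fc: "f x \<in> carrier N" if "x \<in> carrier M" for x
    using f that by (auto simp: mod_hom_def)
  have "localize_map R p N f X \<in> carrier (localize R p N)"
    if "X \<in> carrier (localize R p M)" for X
    using that by (cases rule: M.localize_cases) (simp add: map fc N.frac_in_localize)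
  moreover have "localize_map R p N f (X \<oplus>\<^bsub>localize R p M\<^esub> Y)
      = localize_map R p N f X \<oplus>\<^bsub>localize R p N\<^esub> localize_map R p N f Y"
    if X: "X \<in> carrier (localize R p M)" and Y: "Y \<in> carrier (localize R p M)" for X Y
  proof -
    obtain x s where x: "X = frac R p M x s" "x \<in> carrier M" "s \<in> carrier R - p"
      using X by (rule M.localize_cases)
    obtain y t where y: "Y = frac R p M y t" "y \<in> carrier M" "t \<in> carrier R - p"
      using Y by (rule M.localize_cases)
    have "f ((t \<odot>\<^bsub>M\<^esub> x) \<oplus>\<^bsub>M\<^esub> (s \<odot>\<^bsub>M\<^esub> y)) = (t \<odot>\<^bsub>N\<^esub> f x) \<oplus>\<^bsub>N\<^esub> (s \<odot>\<^bsub>N\<^esub> f y)"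
      using f x y by (simp add: mod_hom_def)
    then show ?thesis
      using x y M.mult_denom[OF x(3) y(3)] by (simp add: M.frac_add N.frac_add map fc)
  qed
  moreover have "localize_map R p N f (a \<odot>\<^bsub>localize R p M\<^esub> X)
      = a \<odot>\<^bsub>localize R p N\<^esub> localize_map R p N f X"
    if a: "a \<in> carrier R" and X: "X \<in> carrier (localize R p M)" for a X
  proof -
    obtain x s where x: "X = frac R p M x s" "x \<in> carrier M" "s \<in> carrier R - p"
      using X by (rule M.localize_cases)
    have "f (a \<odot>\<^bsub>M\<^esub> x) = a \<odot>\<^bsub>N\<^esub> f x"
      using f a x by (simp add: mod_hom_def)
    then show ?thesis
      using a x by (simp add: M.frac_smult N.frac_smult map fc)
  qed
  ultimately show ?thesis
    by (simp add: mod_hom_def)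
qed

text \<open>
  Equality of two fractions of images is a single equation between values of \<open>f\<close>, since the
  scalars can be moved inside; injectivity of \<open>f\<close> then pulls that equation back.
\<close>

lemma localize_map_mono:
  assumes mods: "module R M" "module R N" "primeideal p R" and f: "f \<in> mod_mono R M N"
  shows "localize_map R p N f \<in> mod_mono R (localize R p M) (localize R p N)"
proof -
  interpret M: module_at_prime R M p
    by (intro module_at_prime.intro assms)
  interpret N: module_at_prime R N p
    by (intro module_at_prime.intro assms)
  have hom: "f \<in> mod_hom R M N" and inj: "inj_on f (carrier M)"
    using f by (auto simp: mod_mono_def)
  have "X = Y"
    if X: "X \<in> carrier (localize R p M)" and Y: "Y \<in> carrier (localize R p M)"
      and eq: "localize_map R p N f X = localize_map R p N f Y" for X Y
  proof -
    obtain x s where x: "X = frac R p M x s" "x \<in> carrier M" "s \<in> carrier R - p"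
      using X by (rule M.localize_cases)
    obtain y t where y: "Y = frac R p M y t" "y \<in> carrier M" "t \<in> carrier R - p"
      using Y by (rule M.localize_cases)
    have "f x \<in> carrier N" "f y \<in> carrier N"
      using hom x y by (auto simp: mod_hom_def)
    moreover have "frac R p N (f x) s = frac R p N (f y) t"
      using eq x y by (simp add: localize_map_frac[OF mods hom])
    ultimately have "((f x, s), (f y, t)) \<in> frac_rel R p N"
      using N.frac_eq_iff x(3) y(3) by blast
    then obtain u where u: "u \<in> carrier R - p"
      and "(u \<otimes>\<^bsub>R\<^esub> t) \<odot>\<^bsub>N\<^esub> f x = (u \<otimes>\<^bsub>R\<^esub> s) \<odot>\<^bsub>N\<^esub> f y"
      unfolding N.frac_rel_iff by blast
    then have "f ((u \<otimes>\<^bsub>R\<^esub> t) \<odot>\<^bsub>M\<^esub> x) = f ((u \<otimes>\<^bsub>R\<^esub> s) \<odot>\<^bsub>M\<^esub> y)"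
      using hom x y by (simp add: mod_hom_def)
    then have "(u \<otimes>\<^bsub>R\<^esub> t) \<odot>\<^bsub>M\<^esub> x = (u \<otimes>\<^bsub>R\<^esub> s) \<odot>\<^bsub>M\<^esub> y"
      using u x y by (auto dest: inj_onD[OF inj])
    then have "((x, s), (y, t)) \<in> frac_rel R p M"
      unfolding M.frac_rel_iff using u x y by blast
    then show ?thesis
      unfolding x(1) y(1) by (rule M.frac_eqI)
  qed
  then show ?thesis
    using localize_map_hom[OF mods hom] by (auto simp: mod_mono_def inj_on_def)
qed

section \<open>Hulls are invariant under isomorphism over the base\<close>

lemma mod_hom_comp:
  assumes "f \<in> mod_hom R L M" "g \<in> mod_hom R M N"
  shows "(\<lambda>x. g (f x)) \<in> mod_hom R L N"
  using assms by (auto simp: mod_hom_def Pi_iff)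

lemma mod_iso_inv:
  assumes "module R M" and f: "f \<in> mod_iso R M N"
  shows "inv_into (carrier M) f \<in> mod_hom R N M"
proof -
  interpret M: module R M by fact
  have bij: "bij_betw f (carrier M) (carrier N)" and hom: "f \<in> mod_hom R M N"
    using f by (auto simp: mod_iso_def)
  let ?g = "inv_into (carrier M) f"
  have g: "?g y \<in> carrier M" "f (?g y) = y" if "y \<in> carrier N" for y
    using bij that by (auto simp: bij_betw_def inv_into_into f_inv_into_f)
  have gf: "?g (f x) = x" if "x \<in> carrier M" for x
    using bij that by (simp add: bij_betw_def)
  have "?g (x \<oplus>\<^bsub>N\<^esub> y) = ?g x \<oplus>\<^bsub>M\<^esub> ?g y" if "x \<in> carrier N" "y \<in> carrier N" for x y
  proof -
    have "f (?g x \<oplus>\<^bsub>M\<^esub> ?g y) = x \<oplus>\<^bsub>N\<^esub> y"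
      using hom g that by (simp add: mod_hom_def)
    then show ?thesis
      using gf g that by (metis M.M.add.m_closed)
  qed
  moreover have "?g (a \<odot>\<^bsub>N\<^esub> x) = a \<odot>\<^bsub>M\<^esub> ?g x" if "a \<in> carrier R" "x \<in> carrier N" for a x
  proof -
    have "f (a \<odot>\<^bsub>M\<^esub> ?g x) = a \<odot>\<^bsub>N\<^esub> x"
      using hom g that by (simp add: mod_hom_def)
    then show ?thesis
      using gf g that by (metis M.smult_closed)
  qed
  ultimately show ?thesis
    using g by (simp add: mod_hom_def)
qed

text \<open>
  The conjugate \<open>\<phi> u \<phi>\<^sup>-\<^sup>1\<close> fixes the image of \<open>j'\<close> because \<open>\<phi>\<close> takes \<open>j\<close> to \<open>j'\<close>, so it is an
  automorphism of \<open>E'\<close>; conjugating back shows that \<open>u\<close> is bijective.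
\<close>

lemma endo_minimal_transfer:
  assumes "module R E" and j: "j \<in> carrier N \<rightarrow> carrier E"
    and min: "endo_minimal R N j' E'" and iso: "isomorphic_over R N j E j' E'"
  shows "endo_minimal R N j E"
  unfolding endo_minimal_def
proof (intro ballI impI)
  fix u
  assume u: "u \<in> mod_hom R E E" and fix_u: "\<forall>x\<in>carrier N. u (j x) = j x"
  obtain \<phi> where \<phi>: "\<phi> \<in> mod_iso R E E'" and over: "\<forall>x\<in>carrier N. \<phi> (j x) = j' x"
    using iso by (auto simp: isomorphic_over_def)
  have bij: "bij_betw \<phi> (carrier E) (carrier E')" and hom: "\<phi> \<in> mod_hom R E E'"
    using \<phi> by (auto simp: mod_iso_def)
  let ?\<psi> = "inv_into (carrier E) \<phi>"
  have \<psi>: "?\<psi> (\<phi> x) = x" if "x \<in> carrier E" for x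
    using bij that by (simp add: bij_betw_def)
  have uc: "u x \<in> carrier E" if "x \<in> carrier E" for x
    using u that by (auto simp: mod_hom_def)
  let ?v = "\<lambda>y. \<phi> (u (?\<psi> y))"
  have "?v \<in> mod_hom R E' E'"
    by (intro mod_hom_comp[OF mod_iso_inv[OF \<open>module R E\<close> \<phi>]] mod_hom_comp[OF u hom])
  moreover have "?v (j' x) = j' x" if "x \<in> carrier N" for x
    using j over fix_u \<psi> that by (metis Pi_mem)
  ultimately have "bij_betw ?v (carrier E') (carrier E')"
    using min by (auto simp: endo_minimal_def mod_iso_def)
  then have "bij_betw (?\<psi> \<circ> (?v \<circ> \<phi>)) (carrier E) (carrier E)"
    using bij by (meson bij_betw_inv_into bij_betw_trans)
  moreover have "(?\<psi> \<circ> (?v \<circ> \<phi>)) x = u x" if "x \<in> carrier E" for x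
    using \<psi> uc that by simp
  ultimately have "bij_betw u (carrier E) (carrier E)"
    using bij_betw_cong[of "carrier E" "?\<psi> \<circ> (?v \<circ> \<phi>)" u] by blast
  with u show "u \<in> mod_iso R E E"
    by (simp add: mod_iso_def)
qed

lemma class_hull_transfer:
  fixes C :: "('r, 'u) module set"
  assumes ext: "class_extension R C N j E"
    and hull: "class_hull R C N j' E'" and iso: "isomorphic_over R N j E j' E'"
  shows "class_hull R C N j E"
proof -
  obtain \<phi> where \<phi>: "\<phi> \<in> mod_hom R E E'" and over: "\<forall>x\<in>carrier N. \<phi> (j x) = j' x"
    using iso by (auto simp: isomorphic_over_def mod_iso_def)
  have "\<exists>h\<in>mod_hom R E F. \<forall>x\<in>carrier N. i x = h (j x)"
    if F: "class_extension R C N i F" for F :: "('r, 'u) module" and i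
  proof -
    obtain h where "h \<in> mod_hom R E' F" "\<forall>x\<in>carrier N. i x = h (j' x)"
      using hull F unfolding class_hull_def pre_envelope_def by blast
    then show ?thesis
      using over by (intro bexI[OF _ mod_hom_comp[OF \<phi>]]) auto
  qed
  moreover have "module R E" "j \<in> carrier N \<rightarrow> carrier E"
    using ext by (auto simp: class_extension_def in_class_def mod_mono_def mod_hom_def)
  then have "endo_minimal R N j E"
    using endo_minimal_transfer hull iso by (auto simp: class_hull_def)
  ultimately show ?thesis
    using ext by (auto simp: class_hull_def pre_envelope_def)
qed

theorem theorem7p10:
  fixes R :: "('r, 'c) ring_scheme"
    and C :: "('r, 'u) module set"
    and M :: "('r, 'm) module"
    and p :: "'r set"
    and H :: "('r, 'h) module" and \<iota> :: "'m \<Rightarrow> 'h"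
    and H' :: "('r, 'k) module" and \<iota>' :: "('m \<times> 'r) set \<Rightarrow> 'k"
  assumes "cring R"
    and "hull_class R C"
    and "module R M"
    and "primeideal p R"
    and hull: "class_hull R C M \<iota> H"
    and in_C: "in_class R C (localize R p H)"
    and not_minimal: "\<not> minimal_extension R C (localize R p M)
                          (localize_map R p H \<iota>) (localize R p H)"
    and local_hull: "class_hull R C (localize R p M) \<iota>' H'"
  shows "\<not> isomorphic_over R (localize R p M)
            (localize_map R p H \<iota>) (localize R p H) \<iota>' H'"
proof
  assume iso: "isomorphic_over R (localize R p M)
    (localize_map R p H \<iota>) (localize R p H) \<iota>' H'"
  have "module R H" "\<iota> \<in> mod_mono R M H"
    using hull by (auto simp: class_hull_def pre_envelope_def class_extension_def in_class_def)
  then have ext: "class_extension R C (localize R p M) (localize_map R p H \<iota>) (localize R p H)"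
    using localize_map_mono[OF \<open>module R M\<close> _ \<open>primeideal p R\<close>] in_C
    by (simp add: class_extension_def)
  then have "class_hull R C (localize R p M) (localize_map R p H \<iota>) (localize R p H)"
    using local_hull iso by (rule class_hull_transfer)
  with ext not_minimal show False
    by (simp add: minimal_extension_def class_hull_def)
qed

end
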